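(* For each positive integer $k$, for all sufficiently large $n$, the edges of $G(n)$ cannot be covered by complete bipartite subgraphs of $G(n)$ in such a way that each vertex belongs to at most $k$ of these subgraphs.
   Context: For a positive integer $n$, $G(n)$ is the bipartite graph with vertices $x_1,\ldots,x_n$ and $y_1,\ldots,y_n$ whose edges are the pairs $x_iy_j$ with $i\le j$. A family of subgraphs covers the edges of $G(n)$ if every edge of $G(n)$ belongs to at least one of the subgraphs (an edge may be covered more than once). *)

theory Defs
  imports "Graph_Theory.Graph_Theory"
begin

datatype vertex = X nat | Y nat

text \<open>
  Following the convention of the library, an undirected graph is a symmetric digraph:
  an edge \<open>x\<^sub>i y\<^sub>j\<close> is represented by the two arcs \<open>(X i, Y j)\<close> and \<open>(Y j, X i)\<close>.
\<close>

definition half_graph :: "nat \<Rightarrow> vertex pair_pre_digraph" where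
  "half_graph n = \<lparr>
     pverts = X ` {1..n} \<union> Y ` {1..n},
     parcs = {(X i, Y j) | i j. 1 \<le> i \<and> i \<le> j \<and> j \<le> n}
           \<union> {(Y j, X i) | i j. 1 \<le> i \<and> i \<le> j \<and> j \<le> n} \<rparr>"

lemma graph_half_graph: "graph (with_proj (half_graph n))"
proof -
  have fin: "finite (pverts (half_graph n))"
    by (simp add: half_graph_def)
  have sub: "parcs (half_graph n) \<subseteq> pverts (half_graph n) \<times> pverts (half_graph n)"
    by (auto simp: half_graph_def)
  have "finite (parcs (half_graph n))"
    by (rule finite_subset[OF sub]) (simp add: fin)
  moreover have "symmetric (with_proj (half_graph n))"
    unfolding symmetric_def sym_def by (auto simp: half_graph_def)
  ultimately show ?thesis
    using fin sub by unfold_locales (auto simp: half_graph_def arc_to_ends_def)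
qed

text \<open>
  The sides may be empty. Such an \<open>H\<close> has no edges, so it never helps to cover anything.
\<close>

definition complete_bipartite :: "('a, 'b) pre_digraph \<Rightarrow> bool" where
  "complete_bipartite H \<longleftrightarrow> (\<exists>r s. K\<^bsub>r,s\<^esub> H)"

definition covers_edges :: "('a, 'b) pre_digraph set \<Rightarrow> ('a, 'b) pre_digraph \<Rightarrow> bool" where
  "covers_edges \<F> G \<longleftrightarrow> (\<forall>e \<in> arcs G. \<exists>H \<in> \<F>. e \<in> arcs H)"

text \<open>
  A finite graph has only finitely many subgraphs, so the cardinality of a set of subgraphs
  containing a given vertex is never the cardinality of an infinite set.
\<close>

lemma (in fin_digraph) finite_subgraphs: "finite {H. subgraph H G}"
proof (rule finite_subset)
  show "{H. subgraph H G} \<subseteq>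
      (\<lambda>(V, A). \<lparr>verts = V, arcs = A, tail = tail G, head = head G\<rparr>)
        ` (Pow (verts G) \<times> Pow (arcs G))"
  proof
    fix H assume "H \<in> {H. subgraph H G}"
    then have "H = \<lparr>verts = verts H, arcs = arcs H, tail = tail G, head = head G\<rparr>"
      and "verts H \<subseteq> verts G" "arcs H \<subseteq> arcs G"
      by (auto simp: subgraph_def compatible_def)
    then show "H \<in> (\<lambda>(V, A). \<lparr>verts = V, arcs = A, tail = tail G, head = head G\<rparr>)
        ` (Pow (verts G) \<times> Pow (arcs G))"
      by (intro image_eqI[where x = "(verts H, arcs H)"]) auto
  qed
qed simp

end

theory Submission
  imports Defs "HOL-Library.Ramsey"
begin

text \<open>
  Number the at most \<open>k\<close> bicliques at each vertex, and colour a pair \<open>i < j\<close> by the two numbers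
  that a biclique covering \<open>x\<^sub>i y\<^sub>j\<close> receives at \<open>x\<^sub>i\<close> and at \<open>y\<^sub>j\<close>. By Ramsey's theorem with
  \<open>k\<^sup>2\<close> colours there are \<open>p < q < r < s\<close> spanning a single colour. Pairs with a common
  smaller or a common larger element are then covered by the same biclique, so one biclique
  covers \<open>x\<^sub>p y\<^sub>q\<close>, \<open>x\<^sub>p y\<^sub>s\<close> and \<open>x\<^sub>r y\<^sub>s\<close>. It must contain \<open>x\<^sub>r y\<^sub>q\<close>, which is not an edge.
\<close>

text \<open>Compatibility with a pair digraph forces \<open>tail H = fst\<close> and
  \<open>head H = snd\<close>, so each arc is its own pair of ends. This links
  \<open>complete_bipartite\<close>, which constrains \<open>arcs_ends\<close>, to covering, which
  speaks of \<open>arcs\<close>.\<close>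

lemma arcs_ends_with_proj_subgraph:
  assumes "subgraph H (with_proj G)"
  shows "arcs_ends H = arcs H"
  using assms by (simp add: subgraph_def compatible_def arcs_ends_def arc_to_ends_def)

text \<open>The three arcs put \<open>a\<close> and \<open>c\<close> in one part and
  \<open>b\<close> and \<open>d\<close> in the other.\<close>

lemma complete_bipartite_arc_exchange:
  assumes "complete_bipartite H" "(a, b) \<in> arcs_ends H"
    "(a, d) \<in> arcs_ends H" "(c, d) \<in> arcs_ends H"
  shows "(c, b) \<in> arcs_ends H"
  using assms unfolding complete_bipartite_def complete_bipartite_digraph_def by auto

lemma half_graph_arc_iff:
  "(X i, Y j) \<in> arcs (with_proj (half_graph n)) \<longleftrightarrow> 1 \<le> i \<and> i \<le> j \<and> j \<le> n"
  by (auto simp: half_graph_def)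

lemma card_ge_4_obtain_less:
  fixes S :: "'a :: linorder set"
  assumes "4 \<le> card S"
  obtains p q r s where "{p, q, r, s} \<subseteq> S" "p < q" "q < r" "r < s"
proof -
  define xs where "xs = sorted_list_of_set S"
  have fin: "finite S"
    using assms by (cases "finite S") auto
  have len: "length xs = card S" and set: "set xs = S" and sorted: "sorted_wrt (<) xs"
    using fin by (simp_all add: xs_def)
  have less: "xs ! i < xs ! j" if "i < j" "j < 4" for i j
    using sorted_wrt_nth_less[OF sorted, of i j] that len assms by simp
  have "xs ! i \<in> S" if "i < 4" for i
    using nth_mem[of i xs] that len set assms by simp
  then show thesis
    using that[of "xs ! 0" "xs ! 1" "xs ! 2" "xs ! 3"] less by simp
qed

text \<open>Ramsey's theorem for pairs with \<open>m\<close> colours and target size 4. The two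
  equalities are those that later identify bicliques: one for pairs sharing the smaller element
  \<open>p\<close>, one for pairs sharing the larger element \<open>s\<close>.\<close>

lemma ramsey_quadruple:
  fixes m :: nat
  obtains N :: nat where
    "\<And>c :: nat \<Rightarrow> nat \<Rightarrow> nat. (\<And>i j. \<lbrakk>i < j; j < N\<rbrakk> \<Longrightarrow> c i j < m) \<Longrightarrow>
      \<exists>p q r s. p < q \<and> q < r \<and> r < s \<and> s < N \<and> c p q = c p s \<and> c r s = c p s"
proof -
  obtain N :: nat where N: "partn_lst {..<N} (replicate m 4) 2"
    using ramsey_full by blast
  have "\<exists>p q r s. p < q \<and> q < r \<and> r < s \<and> s < N \<and> c p q = c p s \<and> c r s = c p s"
    if c: "\<And>i j. i < j \<Longrightarrow> j < N \<Longrightarrow> c i j < m" for c :: "nat \<Rightarrow> nat \<Rightarrow> nat"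
  proof -
    \<comment> \<open>The library colours 2-element sets; \<open>Min\<close> and \<open>Max\<close>
      recover the ordered pair.\<close>
    define f where "f = (\<lambda>e. c (Min e) (Max e))"
    have f: "f {i, j} = c i j" if "i < j" for i j
      using that by (simp add: f_def)
    have "f \<in> [{..<N}]\<^bsup>2\<^esup> \<rightarrow> {..<m}"
      by (auto simp: ordered_nsets_2_eq f c)
    then obtain l S where "l < m" and S: "S \<in> [{..<N}]\<^bsup>4\<^esup>" and mono: "f ` [S]\<^bsup>2\<^esup> \<subseteq> {l}"
      by (rule partn_lstE[OF N]) (simp_all only: length_replicate nth_replicate)
    from S have "S \<subseteq> {..<N}" "card S = 4"
      by (auto simp: nsets_def)
    then obtain p q r s where S4: "{p, q, r, s} \<subseteq> S" and less: "p < q" "q < r" "r < s"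
      by (metis card_ge_4_obtain_less order_refl)
    have "c i j = l" if "i < j" "i \<in> S" "j \<in> S" for i j
    proof -
      have "{i, j} \<in> [S]\<^bsup>2\<^esup>"
        using that by simp
      then have "f {i, j} \<in> {l}"
        using mono by blast
      then show ?thesis
        using f[OF \<open>i < j\<close>] by simp
    qed
    then have "c p q = c p s \<and> c r s = c p s"
      using S4 less by simp
    then show ?thesis
      using S4 less \<open>S \<subseteq> {..<N}\<close> by blast
  qed
  then show thesis
    by (rule that)
qed

lemma finite_card_le_numbering:
  assumes "finite A" "card A \<le> k"
  shows "\<exists>g :: 'a \<Rightarrow> nat. inj_on g A \<and> g ` A \<subseteq> {..<k}"
  using assms card_le_inj[of A "{..<k}"] by auto

theorem theorem1p4:
  fixes k :: nat
  assumes "k \<ge> 1"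
  shows "\<forall>\<^sub>F n in sequentially.
    \<not> (\<exists>\<F>. (\<forall>H \<in> \<F>. subgraph H (with_proj (half_graph n)) \<and> complete_bipartite H)
          \<and> covers_edges \<F> (with_proj (half_graph n))
          \<and> (\<forall>v \<in> verts (with_proj (half_graph n)). card {H \<in> \<F>. v \<in> verts H} \<le> k))"
proof -
  obtain N :: nat where
    N: "\<And>c :: nat \<Rightarrow> nat \<Rightarrow> nat. (\<And>i j. \<lbrakk>i < j; j < N\<rbrakk> \<Longrightarrow> c i j < k * k) \<Longrightarrow>
      \<exists>p q r s. p < q \<and> q < r \<and> r < s \<and> s < N \<and> c p q = c p s \<and> c r s = c p s"
    using ramsey_quadruple[of "k * k"] by blast
  show ?thesis
  proof (intro eventually_sequentiallyI[of N] notI, elim exE conjE)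
    fix n \<F>
    let ?G = "with_proj (half_graph n)"
    assume "N \<le> n"
      and sub: "\<forall>H \<in> \<F>. subgraph H ?G \<and> complete_bipartite H"
      and cov: "covers_edges \<F> ?G"
      and deg: "\<forall>v \<in> verts ?G. card {H \<in> \<F>. v \<in> verts H} \<le> k"
    interpret graph ?G
      by (rule graph_half_graph)
    \<comment> \<open>Since \<open>card\<close> is 0 on infinite sets, finiteness is what turns
      \<open>deg\<close> into a genuine bound and lets the bicliques at each vertex be numbered
      injectively below \<open>k\<close>.\<close>
    have "finite \<F>"
      by (rule finite_subset[OF _ finite_subgraphs]) (use sub in auto)
    then have "\<forall>v \<in> verts ?G. \<exists>g :: (vertex, vertex \<times> vertex) pre_digraph \<Rightarrow> nat.
        inj_on g {H \<in> \<F>. v \<in> verts H} \<and> g ` {H \<in> \<F>. v \<in> verts H} \<subseteq> {..<k}"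
      using deg by (intro ballI finite_card_le_numbering) auto
    then obtain g :: "vertex \<Rightarrow> (vertex, vertex \<times> vertex) pre_digraph \<Rightarrow> nat" where
      g: "\<forall>v \<in> verts ?G. inj_on (g v) {H \<in> \<F>. v \<in> verts H} \<and>
            g v ` {H \<in> \<F>. v \<in> verts H} \<subseteq> {..<k}"
      by (rule bchoice[THEN exE])
    have g_inj: "inj_on (g v) {H \<in> \<F>. v \<in> verts H}" if "v \<in> verts ?G" for v
      using g that by simp
    have g_less: "g v H < k" if "v \<in> verts ?G" "H \<in> \<F>" "v \<in> verts H" for v H
      using g that by (simp add: image_subset_iff)
    \<comment> \<open>Ramsey's indices start at 0, the vertices at 1; after the shift all indices
      below \<open>N\<close> give vertices as soon as \<open>N \<le> n\<close>.\<close>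
    define x where "x i = X (Suc i)" for i
    define y where "y j = Y (Suc j)" for j
    have xy: "x i \<in> verts ?G" "y i \<in> verts ?G" if "i < N" for i
      using that \<open>N \<le> n\<close> by (auto simp: half_graph_def x_def y_def)
    have "\<exists>H\<in>\<F>. (x i, y j) \<in> arcs H" if "i < j" "j < N" for i j
    proof -
      have "(x i, y j) \<in> arcs ?G"
        unfolding x_def y_def half_graph_arc_iff using that \<open>N \<le> n\<close> by simp
      then show ?thesis
        using cov unfolding covers_edges_def by blast
    qed
    then obtain h where h: "\<And>i j. \<lbrakk>i < j; j < N\<rbrakk> \<Longrightarrow> h i j \<in> \<F> \<and> (x i, y j) \<in> arcs (h i j)"
      by metis
    have h_verts: "x i \<in> verts (h i j)" "y j \<in> verts (h i j)" if "i < j" "j < N" for i j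
    proof -
      have H: "subgraph (h i j) ?G" "(x i, y j) \<in> arcs (h i j)"
        using h[OF that] sub by auto
      then have "wf_digraph (h i j)" "tail (h i j) = fst" "head (h i j) = snd"
        by (auto simp: subgraph_def compatible_def)
      then show "x i \<in> verts (h i j)" "y j \<in> verts (h i j)"
        using H wf_digraph.tail_in_verts wf_digraph.head_in_verts by fastforce+
    qed
    \<comment> \<open>The two numbers are the digits of \<open>c i j\<close> in base
      \<open>k\<close>: there are \<open>k * k\<close> colours, and \<open>div\<close> and
      \<open>mod\<close> recover the digits.\<close>
    define c where "c i j = g (x i) (h i j) * k + g (y j) (h i j)" for i j
    have g_h: "g (x i) (h i j) < k" "g (y j) (h i j) < k" if "i < j" "j < N" for i j
      using that h h_verts xy by (auto intro!: g_less)
    have "c i j < k * k" if "i < j" "j < N" for i j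
    proof -
      have "c i j < Suc (g (x i) (h i j)) * k"
        using g_h[OF that] by (simp add: c_def)
      also have "\<dots> \<le> k * k"
        using g_h[OF that] by (intro mult_right_mono) auto
      finally show ?thesis .
    qed
    then obtain p q r s where less: "p < q" "q < r" "r < s" "s < N"
      and eq: "c p q = c p s" "c r s = c p s"
      using N[of c] by auto
    have c_div: "c i j div k = g (x i) (h i j)" and c_mod: "c i j mod k = g (y j) (h i j)"
      if "i < j" "j < N" for i j
      using g_h[OF that] by (auto simp: c_def)
    \<comment> \<open>Both bicliques contain \<open>x p\<close>, where the numbering is injective,
      so equal leading digits make them equal. The last digit does the same at
      \<open>y s\<close>.\<close>
    have "g (x p) (h p q) = g (x p) (h p s)"
      using c_div[of p q] c_div[of p s] eq less by simp
    then have pq: "h p q = h p s"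
      using h h_verts less xy by (intro inj_onD[OF g_inj[of "x p"]]) auto
    have "g (y s) (h r s) = g (y s) (h p s)"
      using c_mod[of r s] c_mod[of p s] eq less by simp
    then have rs: "h r s = h p s"
      using h h_verts less xy by (intro inj_onD[OF g_inj[of "y s"]]) auto
    let ?H = "h p s"
    have H: "subgraph ?H ?G" "complete_bipartite ?H"
      using h[of p s] sub less by auto
    have "(x p, y q) \<in> arcs ?H" "(x p, y s) \<in> arcs ?H" "(x r, y s) \<in> arcs ?H"
      using h[of p q] h[of p s] h[of r s] pq rs less by auto
    then have "(x r, y q) \<in> arcs ?H"
      using complete_bipartite_arc_exchange[OF H(2)]
      unfolding arcs_ends_with_proj_subgraph[OF H(1)] by blast
    then have "(x r, y q) \<in> arcs ?G"
      using H(1) by (auto simp: subgraph_def)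
    \<comment> \<open>Strictness of \<open>q < r\<close> matters here, since \<open>x q\<close> and
      \<open>y q\<close> are adjacent.\<close>
    then show False
      unfolding x_def y_def half_graph_arc_iff using less by simp
  qed
qed

end
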